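(* Let $M$ be a monoid and let $S$ be a generating subset of $M$ with $1\in S$. Then $(M,S)$ admits a factorability structure if, and only if, it admits a quadratic normalisation $(S,N)$ mod $1$ for $M$ such that the weak domino rule is valid for $\overline{N}$.
   Context: Notation. $S_+=S\setminus\{1\}$. $S^*$ is the free monoid over $S$; its elements are words $(s_1,\ldots,s_n)=s_1|\cdots|s_n$, with $|$ denoting the product of $S^*$; $|w|$ is the length of a word $w$. For $f\in M$, $|f|$ is the minimal length of an $S$-word representing $f$ (so $|1|=0$). For a set $A$ and $F:A^2\to A^2$, $F_i$ denotes the map applying $F$ to the entries at positions $i,i+1$ of a word over $A$ (counted from the left). Factorability. A factorisation map for $(M,S)$ is a map $\eta=(\eta',\overline{\eta}):M\to M^2$ with $\eta(1)=(1,1)$ and such that for every $f\ne 1$ in $M$: $\eta'(f)\in S_+$, $\eta'(f)\cdot\overline{\eta}(f)=f$, and $|f|=|\eta'(f)|+|\overline{\eta}(f)|$. Let $\mu:M^2\to M$ be the multiplication and $F=\eta\circ\mu:M^2\to M^2$. A factorability structure on $(M,S)$ is a factorisation map $\eta$ such that for every triple in $M^3$ either the three compositions $F_1F_2F_1F_2$, $F_2F_1F_2$, $F_2F_1F_2F_1$ (rightmost map applied first) take the same value on it, or each of these three maps strictly reduces the sum of the lengths $|\cdot|$ of the entries of the triple. Normalisation. A normalisation is a pair $(A,N)$ of a set $A$ and a map $N:A^*\to A^*$ that is length-preserving, restricts to the identity on $A$ (one-letter words), and satisfies $N(u|v|w)=N(u|N(v)|w)$ for all $A$-words $u,v,w$.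 A word $w$ is $N$-normal if $N(w)=w$. $\overline{N}:A^2\to A^2$ is the restriction of $N$ to length-two words. $(A,N)$ is quadratic if (i) a word is $N$-normal if and only if each of its length-two factors is $N$-normal, and (ii) for every word $w$ there is a finite sequence of positions $(i_1,\ldots,i_k)$, depending on $w$, with $N(w)=\overline{N}_{i_k}\cdots\overline{N}_{i_1}(w)$. An element $e\in A$ is $N$-neutral if $N(w|e)=N(e|w)=N(w)|e$ for every word $w$. A normalisation $(S,N)$ is a normalisation mod $e$ for a monoid $M$ if $e\in S$ is $N$-neutral and $M$ admits (via the evaluation map $S^*\to M$; here the one induced by the inclusion $S\subseteq M$, with $e=1$) the presentation $\langle S\mid \{w=N(w) : w\in S^*\}\cup\{e=1\}\rangle$. Weak domino rule. For a quadratic normalisation $(A,N)$ with $N$-neutral element $e$, the weak domino rule is valid for $F=\overline{N}$ if for all $r_1,r_2,r_1',r_2',s_0,s_1,s_2\in A$ with $F(s_0|r_1)=r_1'|s_1$ and $F(s_1|r_2)=r_2'|s_2$ and with none of $r_1',r_2',s_2$ equal to $e$: if $r_1|r_2$, $r_1'|s_1$ and $r_2'|s_2$ are fixed points of $F$, then so is $r_1'|r_2'$. *)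

theory Defs
  imports Main "HOL-Library.Sublist"
begin

text \<open>
  The ambient monoid is a type of class \<^class>\<open>monoid_mult\<close>. Words over a set \<open>A\<close> are the members of
  \<^term>\<open>lists A\<close>, with \<open>@\<close> as the product of the free monoid; the evaluation map induced by an
  inclusion \<open>S \<subseteq> M\<close> is \<^const>\<open>prod_list\<close>.
\<close>

definition generates :: "'a::monoid_mult set \<Rightarrow> bool" where
  "generates S \<longleftrightarrow> (\<forall>f. \<exists>w \<in> lists S. prod_list w = f)"

definition mlength :: "'a::monoid_mult set \<Rightarrow> 'a \<Rightarrow> nat" where
  "mlength S f = (LEAST n. \<exists>w \<in> lists S. length w = n \<and> prod_list w = f)"

text \<open>
  \<open>apply_at F i w\<close> is \<open>F\<^sub>i(w)\<close>. Positions are counted from 1, whereas \<open>!\<close> and list update count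
  from 0; the term is meaningful only for \<open>1 \<le> i < length w\<close>.
\<close>

definition apply_at :: "('a \<times> 'a \<Rightarrow> 'a \<times> 'a) \<Rightarrow> nat \<Rightarrow> 'a list \<Rightarrow> 'a list" where
  "apply_at F i w = (case F (w ! (i - 1), w ! i) of (a, b) \<Rightarrow> w[i - 1 := a, i := b])"


subsection \<open>Factorability\<close>

definition factorisation_map :: "'a::monoid_mult set \<Rightarrow> ('a \<Rightarrow> 'a \<times> 'a) \<Rightarrow> bool" where
  "factorisation_map S \<eta> \<longleftrightarrow>
     \<eta> 1 = (1, 1) \<and>
     (\<forall>f. f \<noteq> 1 \<longrightarrow>
        fst (\<eta> f) \<in> S - {1} \<and>
        fst (\<eta> f) * snd (\<eta> f) = f \<and>
        mlength S f = mlength S (fst (\<eta> f)) + mlength S (snd (\<eta> f)))"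

definition factorability_structure :: "'a::monoid_mult set \<Rightarrow> ('a \<Rightarrow> 'a \<times> 'a) \<Rightarrow> bool" where
  "factorability_structure S \<eta> \<longleftrightarrow>
     factorisation_map S \<eta> \<and>
     (let F = (\<lambda>(f, g). \<eta> (f * g));
          F1 = apply_at F 1;
          F2 = apply_at F 2;
          p = F1 \<circ> F2 \<circ> F1 \<circ> F2;
          q = F2 \<circ> F1 \<circ> F2;
          r = F2 \<circ> F1 \<circ> F2 \<circ> F1;
          total = (\<lambda>t. sum_list (map (mlength S) t))
      in \<forall>f g h. (let t = [f, g, h] in
           (p t = q t \<and> q t = r t) \<or>
           (total (p t) < total t \<and> total (q t) < total t \<and> total (r t) < total t)))"


subsection \<open>Normalisation\<close>

text \<open>
  A map \<open>A\<^sup>* \<rightarrow> A\<^sup>*\<close> is represented by a function on all lists, of which only the values on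
  \<^term>\<open>lists A\<close> matter.
\<close>

definition normalisation :: "'a set \<Rightarrow> ('a list \<Rightarrow> 'a list) \<Rightarrow> bool" where
  "normalisation A N \<longleftrightarrow>
     (\<forall>w \<in> lists A. N w \<in> lists A) \<and>
     (\<forall>w \<in> lists A. length (N w) = length w) \<and>
     (\<forall>a \<in> A. N [a] = [a]) \<and>
     (\<forall>u \<in> lists A. \<forall>v \<in> lists A. \<forall>w \<in> lists A. N (u @ v @ w) = N (u @ N v @ w))"

definition normal :: "('a list \<Rightarrow> 'a list) \<Rightarrow> 'a list \<Rightarrow> bool" where
  "normal N w \<longleftrightarrow> N w = w"

definition Nbar :: "('a list \<Rightarrow> 'a list) \<Rightarrow> 'a \<times> 'a \<Rightarrow> 'a \<times> 'a" where
  "Nbar N = (\<lambda>(a, b). (N [a, b] ! 0, N [a, b] ! 1))"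

text \<open>\<^const>\<open>sublist\<close> is the relation of being a contiguous factor.\<close>

definition quadratic_normalisation :: "'a set \<Rightarrow> ('a list \<Rightarrow> 'a list) \<Rightarrow> bool" where
  "quadratic_normalisation A N \<longleftrightarrow>
     normalisation A N \<and>
     (\<forall>w \<in> lists A. normal N w \<longleftrightarrow> (\<forall>x. sublist x w \<and> length x = 2 \<longrightarrow> normal N x)) \<and>
     (\<forall>w \<in> lists A. \<exists>is. (\<forall>i \<in> set is. 1 \<le> i \<and> i < length w) \<and>
        N w = fold (apply_at (Nbar N)) is w)"

definition neutral :: "'a set \<Rightarrow> ('a list \<Rightarrow> 'a list) \<Rightarrow> 'a \<Rightarrow> bool" where
  "neutral A N e \<longleftrightarrow>
     e \<in> A \<and> (\<forall>w \<in> lists A. N (w @ [e]) = N w @ [e] \<and> N ([e] @ w) = N w @ [e])"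

text \<open>The least congruence on the free monoid over \<open>S\<close> containing the relations \<open>R\<close>.\<close>

inductive word_cong :: "'a set \<Rightarrow> ('a list \<times> 'a list) set \<Rightarrow> 'a list \<Rightarrow> 'a list \<Rightarrow> bool"
  for S R where
  rel: "(u, v) \<in> R \<Longrightarrow> u \<in> lists S \<Longrightarrow> v \<in> lists S \<Longrightarrow> word_cong S R u v"
| refl: "u \<in> lists S \<Longrightarrow> word_cong S R u u"
| sym: "word_cong S R u v \<Longrightarrow> word_cong S R v u"
| trans: "word_cong S R u v \<Longrightarrow> word_cong S R v w \<Longrightarrow> word_cong S R u w"
| mult: "word_cong S R u v \<Longrightarrow> word_cong S R u' v' \<Longrightarrow> word_cong S R (u @ u') (v @ v')"

text \<open>
  The monoid admits the presentation \<open>\<langle>S | R\<rangle>\<close> via evaluation: the evaluation map is onto, and its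
  kernel is the congruence generated by \<open>R\<close>.
\<close>

definition presented_by :: "'a::monoid_mult set \<Rightarrow> ('a list \<times> 'a list) set \<Rightarrow> bool" where
  "presented_by S R \<longleftrightarrow>
     generates S \<and>
     (\<forall>u \<in> lists S. \<forall>v \<in> lists S. prod_list u = prod_list v \<longleftrightarrow> word_cong S R u v)"

definition normalisation_mod :: "'a::monoid_mult set \<Rightarrow> ('a list \<Rightarrow> 'a list) \<Rightarrow> 'a \<Rightarrow> bool" where
  "normalisation_mod S N e \<longleftrightarrow>
     normalisation S N \<and> neutral S N e \<and>
     presented_by S ({(w, N w) | w. w \<in> lists S} \<union> {([e], [])})"

definition weak_domino_rule :: "'a set \<Rightarrow> 'a \<Rightarrow> ('a \<times> 'a \<Rightarrow> 'a \<times> 'a) \<Rightarrow> bool" where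
  "weak_domino_rule A e F \<longleftrightarrow>
     (\<forall>r1 \<in> A. \<forall>r2 \<in> A. \<forall>r1' \<in> A. \<forall>r2' \<in> A. \<forall>s0 \<in> A. \<forall>s1 \<in> A. \<forall>s2 \<in> A.
        F (s0, r1) = (r1', s1) \<and> F (s1, r2) = (r2', s2) \<and>
        r1' \<noteq> e \<and> r2' \<noteq> e \<and> s2 \<noteq> e \<and>
        F (r1, r2) = (r1, r2) \<and> F (r1', s1) = (r1', s1) \<and> F (r2', s2) = (r2', s2)
        \<longrightarrow> F (r1', r2') = (r1', r2'))"

end

theory Submission
  imports Defs
begin

text \<open>
  A factorisation map \<open>\<eta>\<close> and the normalisation \<open>N\<close> determine each other: \<open>N w\<close> lists the first
  \<open>length w\<close> letters obtained by iterating \<open>\<eta>\<close> on the product of \<open>w\<close>, and \<open>\<eta> f\<close> splits off the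
  first letter of \<open>N w\<close> for a shortest word \<open>w\<close> representing \<open>f\<close>. On letters, \<open>Nbar N (a, b) = \<eta> (a * b)\<close>.

  Given a factorability structure, the triples \<open>(1, f, 1)\<close> and \<open>(s, t * h, 1)\<close> show that normality
  is decided on pairs of neighbours, \<open>(a, g, 1)\<close> that normal forms are reached by local rewriting,
  and \<open>(s0, r1, r2)\<close> is the weak domino rule.

  Conversely, the weak domino rule propagates along normal words: if no step of \<open>F2 \<circ> F1 \<circ> F2\<close> lowers
  the total length of \<open>(f, g, h)\<close>, then \<open>f * g * h\<close> has full length and the outcome is obtained by
  factoring it twice; so two composites either agree or both lower the total length.
\<close>

section \<open>Word length with respect to a generating set\<close>

locale generated_monoid =
  fixes S :: "'a::monoid_mult set"
  assumes gen: "generates S" and one_in: "1 \<in> S"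
begin

abbreviation len :: "'a \<Rightarrow> nat" where "len \<equiv> mlength S"

lemma prod_list_replicate_one [simp]: "prod_list (replicate n (1::'a)) = 1"
  by (induction n) auto

lemma geodesic_word_ex: "\<exists>w \<in> lists S. length w = len f \<and> prod_list w = f"
proof -
  obtain w where "w \<in> lists S" "prod_list w = f"
    using gen unfolding generates_def by blast
  then have "\<exists>n. \<exists>w \<in> lists S. length w = n \<and> prod_list w = f" by blast
  then show ?thesis unfolding mlength_def by (rule LeastI_ex)
qed

lemma len_le: "w \<in> lists S \<Longrightarrow> len (prod_list w) \<le> length w"
  unfolding mlength_def by (rule Least_le) blast

lemma len_one [simp]: "len 1 = 0"
  using len_le[of "[]"] by simp

lemma len_eq_0_iff [simp]: "len f = 0 \<longleftrightarrow> f = 1"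
  using geodesic_word_ex[of f] by auto

lemma len_mult_le: "len (f * g) \<le> len f + len g"
proof -
  obtain v w where "v \<in> lists S" "length v = len f" "prod_list v = f"
    "w \<in> lists S" "length w = len g" "prod_list w = g"
    using geodesic_word_ex by metis
  then show ?thesis using len_le[of "v @ w"] by auto
qed

lemma len_letter_le: "s \<in> S \<Longrightarrow> len s \<le> 1"
  using len_le[of "[s]"] by simp

lemma len_letter: "s \<in> S \<Longrightarrow> s \<noteq> 1 \<Longrightarrow> len s = 1"
  using len_letter_le[of s] len_eq_0_iff[of s] by linarith

lemma letter_if_len_le: assumes "len f \<le> 1" shows "f \<in> S"
proof -
  obtain w where w: "w \<in> lists S" "length w = len f" "prod_list w = f"
    using geodesic_word_ex by metis
  then have "length w \<le> 1" using assms by simp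
  then have "w = [] \<or> (\<exists>s. w = [s])" by (cases w) auto
  then show ?thesis using w one_in by auto
qed

end


section \<open>Factorisation maps and iterated factorisation\<close>

text \<open>For a factorisation map, \<open>\<eta> 1 = (1, 1)\<close>: from \<open>n = len f\<close>
  on, the word only gains trailing letters 1; for smaller \<open>n\<close> it is truncated.\<close>

primrec nf :: "('a \<Rightarrow> 'a \<times> 'a) \<Rightarrow> nat \<Rightarrow> 'a \<Rightarrow> 'a list" where
  "nf \<eta> 0 f = []"
| "nf \<eta> (Suc n) f = fst (\<eta> f) # nf \<eta> n (snd (\<eta> f))"

lemma length_nf [simp]: "length (nf \<eta> n f) = n"
  by (induction n arbitrary: f) auto

locale factorisation = generated_monoid S for S :: "'a::monoid_mult set" +
  fixes \<eta> :: "'a \<Rightarrow> 'a \<times> 'a"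
  assumes fm: "factorisation_map S \<eta>"
begin

lemma eta_one [simp]: "\<eta> 1 = (1, 1)"
  using fm unfolding factorisation_map_def by blast

lemma eta_fst_ne: "f \<noteq> 1 \<Longrightarrow> fst (\<eta> f) \<noteq> 1"
  using fm unfolding factorisation_map_def by blast

lemma eta_fst [simp]: "fst (\<eta> f) \<in> S"
  using fm one_in unfolding factorisation_map_def by (cases "f = 1") auto

lemma eta_prod [simp]: "fst (\<eta> f) * snd (\<eta> f) = f"
  using fm unfolding factorisation_map_def by (cases "f = 1") auto

lemma eta_len: "len (fst (\<eta> f)) + len (snd (\<eta> f)) = len f"
  using fm unfolding factorisation_map_def by (cases "f = 1") auto

lemma eta_eqD:
  assumes "\<eta> f = (s, g)"
  shows "s \<in> S" "s * g = f" "len s + len g = len f" "f \<noteq> 1 \<Longrightarrow> s \<noteq> 1"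
    "f \<noteq> 1 \<Longrightarrow> len f = Suc (len g)"
  using eta_fst[of f] eta_prod[of f] eta_len[of f] eta_fst_ne[of f] assms len_letter[of s] by auto

lemma eta_letter: assumes "s \<in> S" shows "\<eta> s = (s, 1)"
proof (cases "s = 1")
  case False
  obtain a b where ab: "\<eta> s = (a, b)" by fastforce
  have "b = 1" using eta_eqD[OF ab] False len_letter[OF assms False] by simp
  then show ?thesis using eta_eqD(2)[OF ab] ab by simp
qed simp

lemma len_snd_eta_le: "len (snd (\<eta> f)) \<le> len f - 1"
  using eta_eqD[of f "fst (\<eta> f)" "snd (\<eta> f)"] by (cases "f = 1") auto

lemma nf_one [simp]: "nf \<eta> n 1 = replicate n 1"
  by (induction n) auto

lemma nf_in_lists [simp]: "nf \<eta> n f \<in> lists S"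
  by (induction n arbitrary: f) auto

lemma prod_nf: "len f \<le> n \<Longrightarrow> prod_list (nf \<eta> n f) = f"
proof (induction n arbitrary: f)
  case (Suc n)
  then show ?case using len_snd_eta_le[of f] by simp
qed simp

lemma nf_two: assumes "len f \<le> 2" shows "nf \<eta> 2 f = [fst (\<eta> f), snd (\<eta> f)]"
proof -
  have "snd (\<eta> f) \<in> S"
    using len_snd_eta_le[of f] assms by (intro letter_if_len_le) simp
  then show ?thesis by (simp add: numeral_2_eq_2 eta_letter)
qed

lemma nf_two_mult:
  "a \<in> S \<Longrightarrow> b \<in> S \<Longrightarrow> nf \<eta> 2 (a * b) = [fst (\<eta> (a * b)), snd (\<eta> (a * b))]"
  using len_mult_le[of a b] len_letter_le[of a] len_letter_le[of b] by (intro nf_two) simp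

lemma eta_snd_mult: "a \<in> S \<Longrightarrow> b \<in> S \<Longrightarrow> snd (\<eta> (a * b)) \<in> S"
  using nf_two_mult[of a b] nf_in_lists[of 2 "a * b"] by simp

lemma nf_append_ones: "len f \<le> n \<Longrightarrow> nf \<eta> (n + k) f = nf \<eta> n f @ replicate k 1"
proof (induction n arbitrary: f)
  case (Suc n)
  then show ?case using len_snd_eta_le[of f] by simp
qed simp

lemma total_nf: "len f \<le> n \<Longrightarrow> sum_list (map len (nf \<eta> n f)) = len f"
proof (induction n arbitrary: f)
  case (Suc n)
  then show ?case using len_snd_eta_le[of f] eta_len[of f] by simp
qed simp

definition F1 :: "'a list \<Rightarrow> 'a list" where "F1 = apply_at (\<lambda>(f, g). \<eta> (f * g)) 1"
definition F2 :: "'a list \<Rightarrow> 'a list" where "F2 = apply_at (\<lambda>(f, g). \<eta> (f * g)) 2"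

lemma F1_triple [simp]: "F1 [f, g, h] = [fst (\<eta> (f * g)), snd (\<eta> (f * g)), h]"
  by (simp add: F1_def apply_at_def split: prod.split)

lemma F2_triple [simp]: "F2 [f, g, h] = [f, fst (\<eta> (g * h)), snd (\<eta> (g * h))]"
  by (simp add: F2_def apply_at_def numeral_2_eq_2 split: prod.split)

abbreviation total :: "'a list \<Rightarrow> nat" where "total t \<equiv> sum_list (map len t)"

lemma factorability_structure_iff:
  "factorability_structure S \<eta> \<longleftrightarrow>
    (\<forall>f g h. let t = [f, g, h]; p = F1 (F2 (F1 (F2 t))); q = F2 (F1 (F2 t)); r = F2 (F1 (F2 (F1 t)))
      in p = q \<and> q = r \<or> total p < total t \<and> total q < total t \<and> total r < total t)"
  unfolding factorability_structure_def Let_def F1_def[symmetric] F2_def[symmetric] comp_def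
  using fm by blast

lemma total_F1_le: "total (F1 [f, g, h]) \<le> total [f, g, h]"
  using len_mult_le[of f g] eta_len[of "f * g"] by simp

lemma total_F2_le: "total (F2 [f, g, h]) \<le> total [f, g, h]"
  using len_mult_le[of g h] eta_len[of "g * h"] by simp

text \<open>For equal products, erasing the padding by \<open>[1] = []\<close> takes each word to
  the geodesic word \<open>nf \<eta> (len f) f\<close>, which depends on its product
  \<open>f\<close> alone.\<close>

lemma word_cong_iff_prod:
  fixes N :: "'a list \<Rightarrow> 'a list"
  assumes N: "\<And>w. w \<in> lists S \<Longrightarrow> N w = nf \<eta> (length w) (prod_list w)"
    and u: "u \<in> lists S" and v: "v \<in> lists S"
  shows "prod_list u = prod_list v \<longleftrightarrow>
    word_cong S ({(w, N w) | w. w \<in> lists S} \<union> {([1], [])}) u v"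
    (is "_ \<longleftrightarrow> word_cong S ?R u v")
proof
  assume "word_cong S ?R u v"
  then show "prod_list u = prod_list v"
  proof induction
    case (rel u v)
    then show ?case using prod_nf[OF len_le[of u]] by (auto simp: N)
  qed auto
next
  assume eq: "prod_list u = prod_list v"
  have ones: "word_cong S ?R (w @ replicate k 1) w" if "w \<in> lists S" for w k
  proof (induction k)
    case 0
    show ?case using that by (simp add: word_cong.refl)
  next
    case (Suc k)
    have "word_cong S ?R ((w @ replicate k 1) @ [1]) (w @ [])"
      using one_in by (intro word_cong.mult Suc word_cong.rel) auto
    then show ?case by (simp add: replicate_append_same)
  qed
  have nf: "word_cong S ?R w (nf \<eta> (len (prod_list w)) (prod_list w))" if w: "w \<in> lists S" for w
  proof -
    let ?f = "prod_list w"
    have "word_cong S ?R w (N w)"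
      using w by (intro word_cong.rel) (auto simp: N)
    also have "N w = nf \<eta> (len ?f + (length w - len ?f)) ?f"
      using len_le[OF w] N[OF w] by simp
    also have "\<dots> = nf \<eta> (len ?f) ?f @ replicate (length w - len ?f) 1"
      by (rule nf_append_ones) simp
    finally show ?thesis using word_cong.trans[OF _ ones[OF nf_in_lists]] by simp
  qed
  show "word_cong S ?R u v"
    using word_cong.trans[OF nf[OF u] word_cong.sym[OF nf[OF v, folded eq]]] .
qed

lemma normalisation_nf: "normalisation S (\<lambda>w. nf \<eta> (length w) (prod_list w))"
  unfolding normalisation_def by (auto simp: prod_nf[OF len_le] eta_letter)

lemma neutral_nf: "neutral S (\<lambda>w. nf \<eta> (length w) (prod_list w)) 1"
  unfolding neutral_def using one_in nf_append_ones[OF len_le, where k = 1] by auto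

lemma normalisation_mod_nf: "normalisation_mod S (\<lambda>w. nf \<eta> (length w) (prod_list w)) 1"
  unfolding normalisation_mod_def presented_by_def
  using normalisation_nf neutral_nf gen word_cong_iff_prod[where N = "\<lambda>w. nf \<eta> (length w) (prod_list w)"]
  by simp

lemma Nbar_nf:
  assumes "\<And>w. w \<in> lists S \<Longrightarrow> N w = nf \<eta> (length w) (prod_list w)" "a \<in> S" "b \<in> S"
  shows "Nbar N (a, b) = \<eta> (a * b)"
  using assms nf_two_mult[of a b] by (simp add: Nbar_def numeral_2_eq_2)

end

section \<open>Factors of length two and rewriting at positions\<close>

lemma all_pairs_Cons_Cons:
  "(\<forall>x. sublist x (a # b # w) \<and> length x = 2 \<longrightarrow> P x) \<longleftrightarrow>
    P [a, b] \<and> (\<forall>x. sublist x (b # w) \<and> length x = 2 \<longrightarrow> P x)"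
proof -
  have "prefix x (a # b # w) \<and> length x = 2 \<longleftrightarrow> x = [a, b]" for x
    by (cases x; cases "tl x") (auto simp: prefix_Cons)
  then show ?thesis by (metis sublist_Cons_right)
qed

lemma apply_at_Cons:
  "1 \<le> i \<Longrightarrow> apply_at F (Suc i) (a # w) = a # apply_at F i w"
  by (cases i) (auto simp: apply_at_def split: prod.split)

lemma length_apply_at [simp]: "length (apply_at F i w) = length w"
  by (simp add: apply_at_def split: prod.split)

lemma length_fold_apply_at: "length (fold (apply_at F) is w) = length w"
  by (induction "is" arbitrary: w) auto

lemma fold_apply_at_Cons:
  "\<forall>i \<in> set is. 1 \<le> i \<Longrightarrow> fold (apply_at F) (map Suc is) (a # w) = a # fold (apply_at F) is w"
  by (induction "is" arbitrary: w) (auto simp: apply_at_Cons)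


section \<open>From factorability to normalisation\<close>

locale factorable = factorisation S \<eta> for S :: "'a::monoid_mult set" and \<eta> +
  assumes fs: "factorability_structure S \<eta>"
begin

lemma triple_cases:
  obtains "F1 (F2 (F1 (F2 [f, g, h]))) = F2 (F1 (F2 [f, g, h]))"
      "F2 (F1 (F2 [f, g, h])) = F2 (F1 (F2 (F1 [f, g, h])))"
    | "total (F2 (F1 (F2 [f, g, h]))) < total [f, g, h]"
  using fs unfolding factorability_structure_iff Let_def by meson

text \<open>On \<open>(1, f, 1)\<close> the composite \<open>F2 \<circ> F1 \<circ> F2\<close> peels
  two letters off \<open>f\<close> and keeps the total length, so \<open>F1\<close> fixes its
  result.\<close>

lemma eta_first_two: "\<eta> (fst (\<eta> f) * fst (\<eta> (snd (\<eta> f)))) = (fst (\<eta> f), fst (\<eta> (snd (\<eta> f))))"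
proof (cases rule: triple_cases[of 1 f 1])
  case 1
  then show ?thesis by (simp add: eta_letter prod_eq_iff)
next
  case 2
  then show ?thesis using eta_len[of f] eta_len[of "snd (\<eta> f)"] by (simp add: eta_letter)
qed

text \<open>On \<open>(s, t * h, 1)\<close> the composite \<open>F2 \<circ> F1 \<circ> F2\<close>
  stops at \<open>(s, t, h)\<close> without loss of length, while with \<open>F1\<close> in front it
  factors \<open>s * (t * h)\<close> twice; the axiom equates the results.\<close>

lemma eta_extend:
  assumes st: "\<eta> (s * t) = (s, t)" and th: "\<eta> (t * h) = (t, h)"
  shows "\<eta> (s * (t * h)) = (s, t * h)"
proof (cases rule: triple_cases[of s "t * h" 1])
  case 1
  let ?u = "fst (\<eta> (s * (t * h)))" and ?v = "snd (\<eta> (s * (t * h)))"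
  have "?u = s" "fst (\<eta> ?v) = t" "snd (\<eta> ?v) = h"
    using 1(2) st th eta_first_two[of "s * (t * h)"] by simp_all
  then show ?thesis using eta_prod[of ?v] by (simp add: prod_eq_iff)
next
  case 2
  then show ?thesis using eta_eqD(3)[OF th] st th by simp
qed

abbreviation norm :: "'a list \<Rightarrow> 'a list" where "norm w \<equiv> nf \<eta> (length w) (prod_list w)"

lemma norm_pair: "norm [a, b] = [a, b] \<longleftrightarrow> \<eta> (a * b) = (a, b)" if "a \<in> S" "b \<in> S"
  using nf_two_mult[OF that] by (simp add: numeral_2_eq_2 prod_eq_iff)

lemma norm_Cons_iff:
  assumes "w \<in> lists S"
  shows "norm (a # w) = a # w \<longleftrightarrow> \<eta> (a * prod_list w) = (a, prod_list w) \<and> norm w = w"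
proof
  let ?f = "a * prod_list w"
  assume eq: "norm (a # w) = a # w"
  then have a: "fst (\<eta> ?f) = a" and w: "nf \<eta> (length w) (snd (\<eta> ?f)) = w" by simp_all
  show "\<eta> ?f = (a, prod_list w) \<and> norm w = w"
  proof -
    have "a \<in> S" using eta_fst[of ?f] a by simp
    then have "len ?f \<le> Suc (length w)" using len_le[of "a # w"] assms by simp
    then have "prod_list w = snd (\<eta> ?f)"
      using prod_nf[of "snd (\<eta> ?f)" "length w"] w len_snd_eta_le[of ?f] by simp
    then show ?thesis using a w by (simp add: prod_eq_iff)
  qed
qed simp

text \<open>Normality of \<open>(a, b)\<close> comes from \<open>eta_first_two\<close>, the converse
  from \<open>eta_extend\<close>. This matches the recursion in
  \<open>all_pairs_Cons_Cons\<close>.\<close>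

lemma norm_Cons_Cons_iff:
  assumes "a \<in> S" "b \<in> S" "w \<in> lists S"
  shows "norm (a # b # w) = a # b # w \<longleftrightarrow> \<eta> (a * b) = (a, b) \<and> norm (b # w) = b # w"
proof -
  have *: "norm (a # b # w) = a # b # w \<longleftrightarrow>
      \<eta> (a * (b * prod_list w)) = (a, b * prod_list w) \<and> norm (b # w) = b # w"
    using norm_Cons_iff[of "b # w" a] assms by simp
  have **: "\<eta> (b * prod_list w) = (b, prod_list w)" if "norm (b # w) = b # w"
    using that norm_Cons_iff[of w b] assms by blast
  have "\<eta> (a * (b * prod_list w)) = (a, b * prod_list w) \<longleftrightarrow> \<eta> (a * b) = (a, b)"
    if "norm (b # w) = b # w"
    using **[OF that] eta_extend[of a b "prod_list w"] eta_first_two[of "a * (b * prod_list w)"]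
    by (metis fst_conv snd_conv)
  then show ?thesis using * by blast
qed

lemma norm_iff_pairs:
  assumes "w \<in> lists S"
  shows "norm w = w \<longleftrightarrow> (\<forall>x. sublist x w \<and> length x = 2 \<longrightarrow> norm x = x)"
  using assms
proof (induction w rule: induct_list012)
  case (3 a b w)
  then show ?case
    by (simp only: all_pairs_Cons_Cons norm_Cons_Cons_iff norm_pair Cons_in_lists_iff)
qed (auto simp: eta_letter dest: sublist_length_le)

text \<open>Rewriting uses \<open>\<eta> (f * g)\<close> on the whole monoid, so membership in
  \<open>S\<close> need not be tracked; \<open>fold_apply_at_Nbar\<close> passes to
  \<open>Nbar norm\<close>.\<close>

definition reachable :: "'a list \<Rightarrow> 'a list \<Rightarrow> bool" where
  "reachable w v \<longleftrightarrow> (\<exists>is. (\<forall>i \<in> set is. 1 \<le> i \<and> i < length w) \<and>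
    v = fold (apply_at (\<lambda>(f, g). \<eta> (f * g))) is w)"

lemma reachable_refl: "reachable w w"
  unfolding reachable_def by (intro exI[of _ "[]"]) simp

lemma reachable_trans:
  assumes "reachable u v" "reachable v w" shows "reachable u w"
proof -
  obtain xs where xs: "\<forall>i \<in> set xs. 1 \<le> i \<and> i < length u"
    "v = fold (apply_at (\<lambda>(f, g). \<eta> (f * g))) xs u"
    using assms(1) unfolding reachable_def by blast
  obtain ys where ys: "\<forall>i \<in> set ys. 1 \<le> i \<and> i < length v"
    "w = fold (apply_at (\<lambda>(f, g). \<eta> (f * g))) ys v"
    using assms(2) unfolding reachable_def by blast
  show ?thesis
    unfolding reachable_def using xs ys by (intro exI[of _ "xs @ ys"]) (auto simp: length_fold_apply_at)
qed

lemma reachable_Cons: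
  assumes "reachable w v" shows "reachable (a # w) (a # v)"
proof -
  obtain xs where xs: "\<forall>i \<in> set xs. 1 \<le> i \<and> i < length w"
    "v = fold (apply_at (\<lambda>(f, g). \<eta> (f * g))) xs w"
    using assms unfolding reachable_def by blast
  then show ?thesis
    unfolding reachable_def by (intro exI[of _ "map Suc xs"]) (auto simp: fold_apply_at_Cons)
qed

lemma reachable_first:
  "reachable (a # b # w) (fst (\<eta> (a * b)) # snd (\<eta> (a * b)) # w)"
  unfolding reachable_def by (intro exI[of _ "[1]"]) (simp add: apply_at_def split: prod.split)

lemma total_ge_len: "w \<in> lists S \<Longrightarrow> len (prod_list w) \<le> total w"
proof (induction w)
  case (Cons a w)
  then show ?case using len_mult_le[of a "prod_list w"] by simp
qed simp

text \<open>
  Normalise the tail, push the first letter one step, normalise the tail again: by the axiom for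
  the triple \<open>(a, g, 1)\<close>, with \<open>g\<close> the product of the tail, the result is normal or has
  smaller total length.
\<close>

lemma reachable_norm: "w \<in> lists S \<Longrightarrow> reachable w (norm w)"
\<comment> \<open>Lexicographic order: the recursion goes to shorter words, or to one of equal
  length and smaller total.\<close>
proof (induction w rule: wf_induct_rule[OF wf_measures[of "[length, total]"]])
  case (1 w)
  show ?case
  proof (cases "length w \<le> 1")
    case True
    then have "norm w = w" using "1.prems" by (cases w) (auto simp: eta_letter)
    then show ?thesis using reachable_refl[of w] by simp
  next
    case False
    then obtain a w' n where w: "w = a # w'" and n: "length w' = Suc n"
      by (cases w) (auto simp: neq_Nil_conv)
    let ?g = "prod_list w'"
    obtain b g' where bg: "\<eta> ?g = (b, g')" by fastforce
    obtain c a1 where ca: "\<eta> (a * b) = (c, a1)" by fastforce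
    have S: "a \<in> S" "w' \<in> lists S" "b \<in> S" "c \<in> S"
      using "1.prems" w eta_eqD(1)[OF bg] eta_eqD(1)[OF ca] by auto
    have a1: "a1 \<in> S" using eta_snd_mult[OF S(1,3)] ca by simp
    have g': "len g' \<le> n"
      using len_snd_eta_le[of ?g] bg len_le[OF S(2)] n by simp
    let ?v = "a1 # nf \<eta> n g'"
    have v: "norm ?v = nf \<eta> (Suc n) (a1 * g')" using g' by (simp add: prod_nf)
    have lv: "len (a1 * g') \<le> Suc n"
      using len_mult_le[of a1 g'] len_letter_le[OF a1] g' by simp
    let ?x = "c # nf \<eta> (Suc n) (a1 * g')"
    have "reachable w' (norm w')" using "1.IH"[of w'] S(2) w by simp
    then have "reachable w' (b # nf \<eta> n g')" using n bg by simp
    then have "reachable w (a # b # nf \<eta> n g')" unfolding w by (rule reachable_Cons)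
    moreover have "reachable (a # b # nf \<eta> n g') (c # ?v)"
      using reachable_first[of a b "nf \<eta> n g'"] ca by simp
    moreover have "reachable ?v (norm ?v)" using "1.IH"[of ?v] a1 w n by simp
    then have "reachable (c # ?v) ?x" unfolding v by (rule reachable_Cons)
    ultimately have reach: "reachable w ?x" by (blast intro: reachable_trans)
    have prod: "c * (a1 * g') = a * ?g"
      using eta_eqD(2)[OF bg] eta_eqD(2)[OF ca] by (metis mult.assoc)
    show ?thesis
    proof (cases rule: triple_cases[of a ?g 1])
      case 1
      let ?u = "fst (\<eta> (a * ?g))" and ?u' = "snd (\<eta> (a * ?g))"
      have "c = ?u" "\<eta> (a1 * g') = \<eta> ?u'"
        using 1(2) bg ca eta_first_two[of "a * ?g"] by (auto simp: prod_eq_iff)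
      \<comment> \<open>\<open>\<eta>\<close> is injective, as its components multiply back to the
        argument.\<close>
      then have "a1 * g' = ?u'" by (metis eta_prod)
      then have "?x = norm w" using \<open>c = ?u\<close> w n by simp
      then show ?thesis using reach by simp
    next
      case 2
      then have "len c + len (a1 * g') < len a + len ?g"
        using bg ca eta_len[of "a1 * g'"] by simp
      then have "total ?x < total w"
        using total_nf[OF lv] total_ge_len[OF S(2)] w by simp
      moreover have "length ?x = length w" using w n by simp
      ultimately have "reachable ?x (norm ?x)" using "1.IH"[of ?x] S(4) by simp
      moreover have "norm ?x = norm w" using prod_nf[OF lv] prod w n by simp
      ultimately show ?thesis using reachable_trans[OF reach] by simp
    qed
  qed
qed

lemma apply_at_in_lists:
  assumes "w \<in> lists S" "1 \<le> i" "i < length w"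
  shows "apply_at (\<lambda>(f, g). \<eta> (f * g)) i w \<in> lists S"
proof -
  have S: "w ! (i - 1) \<in> S" "w ! i \<in> S" using assms by (auto simp: in_lists_conv_set)
  obtain a b where ab: "\<eta> (w ! (i - 1) * w ! i) = (a, b)" by fastforce
  then have "a \<in> S" "b \<in> S" using eta_eqD(1)[OF ab] eta_snd_mult[OF S] by simp_all
  moreover have "set (w[i - 1 := a, i := b]) \<subseteq> insert b (insert a (set w))"
    using set_update_subset_insert[of w] set_update_subset_insert[of "w[i - 1 := a]"] by blast
  ultimately show ?thesis using assms(1) ab by (auto simp: apply_at_def in_lists_conv_set)
qed

lemma fold_apply_at_Nbar:
  assumes "w \<in> lists S" "\<forall>i \<in> set is. 1 \<le> i \<and> i < length w"
  shows "fold (apply_at (Nbar norm)) is w = fold (apply_at (\<lambda>(f, g). \<eta> (f * g))) is w"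
  using assms
proof (induction "is" arbitrary: w)
  case (Cons i "is")
  have "w ! (i - 1) \<in> S" "w ! i \<in> S" using Cons.prems by (auto simp: in_lists_conv_set)
  then have "Nbar norm (w ! (i - 1), w ! i) = \<eta> (w ! (i - 1) * w ! i)"
    by (intro Nbar_nf) simp_all
  then have "apply_at (Nbar norm) i w = apply_at (\<lambda>(f, g). \<eta> (f * g)) i w"
    by (simp add: apply_at_def)
  then show ?case using Cons apply_at_in_lists[of w i] by simp
qed simp

lemma quadratic_normalisation_norm: "quadratic_normalisation S norm"
  unfolding quadratic_normalisation_def
proof (intro conjI ballI)
  show "normalisation S norm" by (rule normalisation_nf)
  show "normal norm w \<longleftrightarrow> (\<forall>x. sublist x w \<and> length x = 2 \<longrightarrow> normal norm x)"
    if "w \<in> lists S" for w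
    unfolding normal_def using that by (rule norm_iff_pairs)
  show "\<exists>is. (\<forall>i \<in> set is. 1 \<le> i \<and> i < length w) \<and> norm w = fold (apply_at (Nbar norm)) is w"
    if "w \<in> lists S" for w
    using reachable_norm[OF that] fold_apply_at_Nbar[OF that] unfolding reachable_def by metis
qed

text \<open>As \<open>(r1, r2)\<close> is fixed, \<open>F2 \<circ> F1 \<circ> F2\<close> sends
  \<open>(s0, r1, r2)\<close> to \<open>(r1', r2', s2)\<close>. Three nontrivial letters have the
  maximal total 3, so no length is lost and the axiom makes \<open>F1\<close> fix the
  result.\<close>

lemma weak_domino_norm: "weak_domino_rule S 1 (Nbar norm)"
  unfolding weak_domino_rule_def
proof (intro ballI impI, elim conjE)
  fix r1 r2 r1' r2' s0 s1 s2
  assume S: "r1 \<in> S" "r2 \<in> S" "r1' \<in> S" "r2' \<in> S" "s0 \<in> S" "s1 \<in> S" "s2 \<in> S"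
    and ne: "r1' \<noteq> 1" "r2' \<noteq> 1" "s2 \<noteq> 1"
  have N: "Nbar norm (a, b) = \<eta> (a * b)" if "a \<in> S" "b \<in> S" for a b
    using that by (intro Nbar_nf) simp_all
  assume "Nbar norm (s0, r1) = (r1', s1)" "Nbar norm (s1, r2) = (r2', s2)"
    "Nbar norm (r1, r2) = (r1, r2)"
  then have *: "\<eta> (s0 * r1) = (r1', s1)" "\<eta> (s1 * r2) = (r2', s2)" "\<eta> (r1 * r2) = (r1, r2)"
    using S by (simp_all add: N)
  have "\<eta> (r1' * r2') = (r1', r2')"
  proof (cases rule: triple_cases[of s0 r1 r2])
    case 1
    then show ?thesis using * by (simp add: prod_eq_iff)
  next
    case 2
    then show ?thesis
      using * ne S len_letter_le[of s0] len_letter_le[of r1] len_letter_le[of r2]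
      by (simp add: len_letter)
  qed
  then show "Nbar norm (r1', r2') = (r1', r2')" using S by (simp add: N)
qed

end


section \<open>From normalisation to factorability\<close>

text \<open>What the length argument takes from \<open>N\<close>: locality of normality, with
  arbitrary elements as remainders, and the weak domino rule in terms of
  \<open>\<eta>\<close>.\<close>

locale domino = factorisation S \<eta> for S :: "'a::monoid_mult set" and \<eta> +
  assumes eta_first_two: "\<eta> f = (s, g) \<Longrightarrow> \<eta> g = (t, h) \<Longrightarrow> \<eta> (s * t) = (s, t)"
    and eta_extend: "\<eta> (s * t) = (s, t) \<Longrightarrow> \<eta> (t * h) = (t, h) \<Longrightarrow> \<eta> (s * (t * h)) = (s, t * h)"
    and eta_domino: "s0 \<in> S \<Longrightarrow> r1 \<in> S \<Longrightarrow> r2 \<in> S \<Longrightarrow>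
      \<eta> (s0 * r1) = (r1', s1) \<Longrightarrow> \<eta> (s1 * r2) = (r2', s2) \<Longrightarrow> \<eta> (r1 * r2) = (r1, r2) \<Longrightarrow>
      r1' \<noteq> 1 \<Longrightarrow> r2' \<noteq> 1 \<Longrightarrow> s2 \<noteq> 1 \<Longrightarrow> \<eta> (r1' * r2') = (r1', r2')"
begin

text \<open>
  The first letter of \<open>s * g\<close> can be computed from the first letter of \<open>g\<close> alone, unless some length
  drops: by induction \<open>s' * g'\<close> begins with \<open>r2'\<close>, and the weak domino rule makes \<open>(r', r2')\<close> normal.
\<close>

lemma letter_mult_eta:
  assumes "s \<in> S" "\<eta> g = (r, g')" "\<eta> (s * r) = (r', s')"
    "len (s * r) = len s + len r" "len (s' * g') = len s' + len g'"
  shows "len (s * g) = len s + len g \<and> \<eta> (s * g) = (r', s' * g')"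
  using assms
proof (induction "len g" arbitrary: s g r g' r' s' rule: less_induct)
  case less
  note g = eta_eqD[OF less.prems(2)]
  note sr = eta_eqD[OF less.prems(3)]
  consider "s = 1" | "g = 1" | "g' = 1" | "s \<noteq> 1" "g \<noteq> 1" "g' \<noteq> 1" by blast
  then show ?case
  proof cases
    case 1
    then show ?thesis using less.prems g eta_letter[of r] by auto
  next
    case 2
    then show ?thesis using less.prems eta_letter[of s] by auto
  next
    case 3
    then show ?thesis using less.prems g by auto
  next
    case 4
    have len: "len s = 1" "len r = 1" "len g = Suc (len g')"
      using 4 g len_letter less.prems(1) by auto
    then have "s * r \<noteq> 1" using less.prems(4) by auto
    then have r': "r' \<noteq> 1" "len r' = 1" "len s' = 1"
      using sr len less.prems(4) len_letter by auto
    then have s': "s' \<in> S" by (intro letter_if_len_le) simp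
    obtain r2 g'' where g': "\<eta> g' = (r2, g'')" by fastforce
    obtain r2' s2 where sr2: "\<eta> (s' * r2) = (r2', s2)" by fastforce
    note g'2 = eta_eqD[OF g']
    note sr22 = eta_eqD[OF sr2]
    have len2: "len g' = Suc (len g'')" "len r2 = 1" using g'2 4 len_letter by auto
    have eq: "s' * g' = s' * r2 * g''" "s' * g' = r2' * (s2 * g'')"
      using g'2(2) sr22(2) by (metis mult.assoc)+
    \<comment> \<open>Since \<open>s' * g'\<close> has full length, so have its subproducts, by
      subadditivity.\<close>
    have sr2len: "len (s' * r2) = len s' + len r2"
      using len_mult_le[of "s' * r2" g''] len_mult_le[of s' r2] eq(1) less.prems(5) len2 by simp
    then have "s' * r2 \<noteq> 1" using r' by auto
    then have r2': "r2' \<noteq> 1" "len r2' = 1" "len s2 = 1"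
      using sr22 sr2len len2 r' len_letter by auto
    have "len (s2 * g'') = len s2 + len g''"
      using len_mult_le[of r2' "s2 * g''"] len_mult_le[of s2 g''] eq(2) less.prems(5) len2 r' r2' by simp
    then have IH: "\<eta> (s' * g') = (r2', s2 * g'')"
      using less.hyps[OF _ s' g' sr2 sr2len] len by simp
    \<comment> \<open>Full length makes \<open>r'\<close>, \<open>r2'\<close> and \<open>s2\<close>
      nontrivial, as the weak domino rule requires.\<close>
    have "s2 \<noteq> 1" using r2'(3) by auto
    then have "\<eta> (r' * r2') = (r', r2')"
      using eta_domino[OF less.prems(1) g(1) g'2(1) less.prems(3) sr2
          eta_first_two[OF less.prems(2) g'] r'(1) r2'(1)] by simp
    then have "\<eta> (r' * (s' * g')) = (r', s' * g')"
      using eta_extend[of r' r2' "s2 * g''"] IH eq(2) by simp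
    moreover have "r' * (s' * g') = s * g" using g(2) sr(2) by (metis mult.assoc)
    ultimately have eta: "\<eta> (s * g) = (r', s' * g')" by simp
    then show ?thesis using eta_eqD(3)[OF eta] less.prems(5) len r' by simp
  qed
qed

text \<open>Induction on the length of \<open>f\<close> reduces this to
  \<open>letter_mult_eta\<close>: with \<open>f = x * f'\<close>, the hypothesis factors
  \<open>f' * g\<close>, and the letter case carries \<open>x\<close> past the first letter
  found.\<close>

lemma mult_eta:
  assumes "\<eta> g = (s, k)" "\<eta> (f * s) = (u, v)"
    "len (f * s) = len f + len s" "len (v * k) = len v + len k"
  shows "len (f * g) = len f + len g \<and> \<eta> (f * g) = (u, v * k)"
  using assms
proof (induction "len f" arbitrary: f u v rule: less_induct)
  case less
  note g = eta_eqD[OF less.prems(1)]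
  consider "f = 1" | "g = 1" | "f \<noteq> 1" "g \<noteq> 1" by blast
  then show ?case
  proof cases
    case 1
    then show ?thesis using less.prems g eta_letter[of s] by auto
  next
    case 2
    then show ?thesis using less.prems by auto
  next
    case 3
    have s: "len s = 1" using g 3 len_letter by auto
    obtain x f' where f: "\<eta> f = (x, f')" by fastforce
    note f2 = eta_eqD[OF f]
    have x: "len x = 1" "len f = Suc (len f')" using f2 3 len_letter by auto
    have fs: "f * s = x * (f' * s)" using f2(2) by (metis mult.assoc)
    have f's: "len (f' * s) = len f' + len s"
      using len_mult_le[of x "f' * s"] len_mult_le[of f' s] fs less.prems(3) x by simp
    then have f's1: "f' * s \<noteq> 1" using s by auto
    obtain y v' where yv: "\<eta> (f' * s) = (y, v')" by fastforce
    note yv2 = eta_eqD[OF yv]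
    have y: "len y = 1" "len v' = len f'" using yv2 f's1 f's s len_letter by auto
    obtain u' x' where ux: "\<eta> (x * y) = (u', x')" by fastforce
    note ux2 = eta_eqD[OF ux]
    have eq: "f * s = x * y * v'" "f * s = u' * (x' * v')"
      using fs yv2(2) ux2(2) by (metis mult.assoc)+
    have xy: "len (x * y) = len x + len y"
      using len_mult_le[of "x * y" v'] len_mult_le[of x y] eq(1) less.prems(3) x y s by simp
    then have "x * y \<noteq> 1" using x by auto
    then have u': "len u' = 1" "len x' = 1" using ux2 xy x y len_letter by auto
    have "len (x' * v') = len x' + len v'"
      using len_mult_le[of u' "x' * v'"] len_mult_le[of x' v'] eq(2) less.prems(3) x y s u' by simp
    \<comment> \<open>The letter case for \<open>x * (f' * s)\<close> expresses the given
      \<open>u\<close> and \<open>v\<close> through the factorisation of \<open>x * y\<close>, which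
      reappears for \<open>x * (f' * g)\<close>.\<close>
    then have "\<eta> (f * s) = (u', x' * v')"
      using letter_mult_eta[OF f2(1) yv ux xy] fs by simp
    then have uv: "u = u'" "v = x' * v'" using less.prems(2) by simp_all
    have lv: "len v = Suc (len v')"
      using eta_eqD(3)[OF less.prems(2)] less.prems(3) x y u' uv(1) s by simp
    have vk: "v * k = x' * (v' * k)" using uv(2) by (simp add: mult.assoc)
    have v'k: "len (v' * k) = len v' + len k"
      using len_mult_le[of x' "v' * k"] len_mult_le[of v' k] vk less.prems(4) lv u' by simp
    have IH: "len (f' * g) = len f' + len g" "\<eta> (f' * g) = (y, v' * k)"
      using less.hyps[OF _ less.prems(1) yv f's v'k] x by simp_all
    have "len (x' * (v' * k)) = len x' + len (v' * k)"
      using vk v'k less.prems(4) lv u' by simp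
    then have "len (x * (f' * g)) = len x + len (f' * g)" "\<eta> (x * (f' * g)) = (u', x' * (v' * k))"
      using letter_mult_eta[OF f2(1) IH(2) ux xy] by simp_all
    moreover have "x * (f' * g) = f * g" using f2(2) by (metis mult.assoc)
    ultimately show ?thesis using vk uv IH(1) x by simp
  qed
qed

text \<open>The common value of the composites on triples whose product \<open>f\<close> has full
  length.\<close>

abbreviation geo :: "'a \<Rightarrow> 'a list" where
  "geo f \<equiv> F2 [fst (\<eta> f), snd (\<eta> f), 1]"

lemma F2_F1_F2_geo:
  assumes "total [f, g, h] \<le> total (F2 (F1 (F2 [f, g, h])))"
  shows "len (f * (g * h)) = total [f, g, h]" "F2 (F1 (F2 [f, g, h])) = geo (f * (g * h))"
proof -
  obtain s k where sk: "\<eta> (g * h) = (s, k)" by fastforce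
  obtain u v where uv: "\<eta> (f * s) = (u, v)" by fastforce
  have le: "len f + len g + len h \<le> len u + len (v * k)"
    using assms sk uv eta_len[of "v * k"] by simp
  note * = eta_eqD(3)[OF sk] eta_eqD(3)[OF uv]
    len_mult_le[of g h] len_mult_le[of f s] len_mult_le[of v k]
  \<comment> \<open>No step raises the total, so no loss overall means no loss in each step; these
    are the premises of \<open>mult_eta\<close>.\<close>
  have "len (f * s) = len f + len s" "len (v * k) = len v + len k" "len (g * h) = len g + len h"
    using le * by linarith+
  then show "len (f * (g * h)) = total [f, g, h]" "F2 (F1 (F2 [f, g, h])) = geo (f * (g * h))"
    using mult_eta[OF sk uv] sk uv by simp_all
qed

lemma total_F2_F1_F2:
  "total (F2 (F1 (F2 [f, g, h]))) \<le> total [f, g, h]"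
  "len (f * (g * h)) \<le> total (F2 (F1 (F2 [f, g, h])))"
proof -
  obtain s k where sk: "\<eta> (g * h) = (s, k)" by fastforce
  obtain u v where uv: "\<eta> (f * s) = (u, v)" by fastforce
  have "f * (g * h) = u * (v * k)"
    using eta_eqD(2)[OF sk] eta_eqD(2)[OF uv] by (metis mult.assoc)
  then show "len (f * (g * h)) \<le> total (F2 (F1 (F2 [f, g, h])))"
    using sk uv eta_len[of "v * k"] len_mult_le[of u "v * k"] by simp
  show "total (F2 (F1 (F2 [f, g, h]))) \<le> total [f, g, h]"
    using sk uv total_F2_le[of f g h] total_F1_le[of f s k] total_F2_le[of u v k] by simp
qed

lemma factorability_structure_eta: "factorability_structure S \<eta>"
  unfolding factorability_structure_iff Let_def
proof (intro allI)
  fix f g h :: 'a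
  let ?t = "[f, g, h]" and ?P = "f * (g * h)"
  let ?q = "F2 (F1 (F2 ?t))"
  let ?r = "F2 (F1 (F2 (F1 ?t)))"
  obtain a b where ab: "\<eta> (f * g) = (a, b)" by fastforce
  then have F1t: "F1 ?t = [a, b, h]" by simp
  have P: "a * (b * h) = ?P" using eta_eqD(2)[OF ab] by (metis mult.assoc)
  have t1: "total [a, b, h] \<le> total ?t" using total_F1_le[of f g h] F1t by simp
  show "F1 ?q = ?q \<and> ?q = ?r \<or>
    total (F1 ?q) < total ?t \<and> total ?q < total ?t \<and> total ?r < total ?t"
  \<comment> \<open>If the product has full length, all composites give \<open>geo\<close>;
    otherwise none keeps the total, since keeping it would force full length.\<close>
  proof (cases "total ?t \<le> len ?P")
    case True
    then have q: "?q = geo ?P"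
      using total_F2_F1_F2(2)[of f g h] by (intro F2_F1_F2_geo(2)) linarith
    have "total [a, b, h] \<le> total (F2 (F1 (F2 [a, b, h])))"
      using t1 True total_F2_F1_F2(2)[of a b h, unfolded P] by linarith
    then have "?r = geo ?P" unfolding F1t P[symmetric] by (rule F2_F1_F2_geo(2))
    moreover have "F1 (geo ?P) = geo ?P"
      using eta_first_two[of ?P "fst (\<eta> ?P)" "snd (\<eta> ?P)"] by (simp add: prod_eq_iff)
    ultimately show ?thesis using q by simp
  next
    case False
    then have q: "total ?q < total ?t"
      using F2_F1_F2_geo(1)[of f g h] by linarith
    obtain x y z where "?q = [x, y, z]" by simp
    then have p: "total (F1 ?q) \<le> total ?q" using total_F1_le by metis
    \<comment> \<open>Either the initial \<open>F1\<close> already lowers the total, or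
      \<open>(a, b, h)\<close> has the same total and product as the original triple and the
      argument for \<open>?q\<close> applies.\<close>
    have "total ?r < total ?t"
    proof (cases "total [a, b, h] < total ?t")
      case True
      then show ?thesis unfolding F1t using total_F2_F1_F2(1)[of a b h] by linarith
    next
      case False': False
      then show ?thesis
        unfolding F1t using F2_F1_F2_geo(1)[of a b h, unfolded P] t1 False by linarith
    qed
    then show ?thesis using p q by linarith
  qed
qed

end

section \<open>The factorisation map of a normalisation\<close>

locale normalised = generated_monoid S for S :: "'a::monoid_mult set" +
  fixes N :: "'a list \<Rightarrow> 'a list"
  assumes quadratic: "quadratic_normalisation S N" and mod: "normalisation_mod S N 1"
begin

lemma normalisation: "normalisation S N"
  using mod unfolding normalisation_mod_def by blast

lemma N_in_lists [simp]: "w \<in> lists S \<Longrightarrow> N w \<in> lists S"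
  using normalisation unfolding normalisation_def by blast

lemma length_N [simp]: "w \<in> lists S \<Longrightarrow> length (N w) = length w"
  using normalisation unfolding normalisation_def by blast

lemma N_absorb: "u \<in> lists S \<Longrightarrow> v \<in> lists S \<Longrightarrow> w \<in> lists S \<Longrightarrow> N (u @ N v @ w) = N (u @ v @ w)"
  using normalisation unfolding normalisation_def by metis

lemma N_idem [simp]: "w \<in> lists S \<Longrightarrow> N (N w) = N w"
  using N_absorb[of "[]" w "[]"] by simp

lemma N_append: "u \<in> lists S \<Longrightarrow> v \<in> lists S \<Longrightarrow> N (u @ v) = N (N u @ N v)"
  using N_absorb[of "[]" u v] N_absorb[of "N u" v "[]"] by simp

lemma N_one:
  assumes "w \<in> lists S" shows "N (w @ [1]) = N w @ [1]" "N (1 # w) = N w @ [1]"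
  using mod assms unfolding normalisation_mod_def neutral_def by auto

lemma ones_in_lists [simp]: "replicate k 1 \<in> lists S"
  using one_in by auto

lemma N_append_ones: "w \<in> lists S \<Longrightarrow> N (w @ replicate k 1) = N w @ replicate k 1"
proof (induction k)
  case (Suc k)
  then have "N ((w @ replicate k 1) @ [1]) = N w @ replicate k 1 @ [1]"
    by (subst N_one) (simp_all only: append_in_lists_conv ones_in_lists append_assoc)
  then show ?case by (simp add: replicate_append_same)
qed simp

lemma N_ones_append: "w \<in> lists S \<Longrightarrow> N (replicate k 1 @ w) = N w @ replicate k 1"
proof (induction k)
  case (Suc k)
  then show ?case
    using N_one(2)[of "replicate k 1 @ w"] by (simp add: replicate_append_same)
qed simp

text \<open>The 1s in the middle move to the right past \<open>v\<close> by neutrality. Hence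
  equality after padding is compatible with concatenation.\<close>

lemma N_mult_ones:
  assumes "u \<in> lists S" "v \<in> lists S"
  shows "N ((u @ v) @ replicate (m + n) 1) = N (N (u @ replicate m 1) @ N (v @ replicate n 1))"
proof -
  have "N (N (u @ replicate m 1) @ N (v @ replicate n 1)) = N (u @ (replicate m 1 @ v) @ replicate n 1)"
    using assms N_append[of "u @ replicate m 1" "v @ replicate n 1"] by simp
  also have "\<dots> = N (u @ N (replicate m 1 @ v) @ replicate n 1)"
    using assms by (intro N_absorb[symmetric]) simp_all
  also have "N (replicate m 1 @ v) = N (v @ replicate m 1)"
    using assms N_ones_append N_append_ones by simp
  also have "N (u @ N (v @ replicate m 1) @ replicate n 1) = N (u @ (v @ replicate m 1) @ replicate n 1)"
    using assms by (intro N_absorb) simp_all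
  finally show ?thesis by (simp add: replicate_add)
qed

lemma N_add_ones:
  assumes "u \<in> lists S" "v \<in> lists S" "N (u @ replicate m 1) = N (v @ replicate n 1)"
  shows "N (u @ replicate (m + k) 1) = N (v @ replicate (n + k) 1)"
  using assms N_append_ones[of "u @ replicate m 1" k] N_append_ones[of "v @ replicate n 1" k]
  by (simp add: replicate_add)

text \<open>The relation \<open>[1] = []\<close> changes the length while \<open>N\<close> preserves
  it, so the invariant of the congruence is equality of normal forms after padding with 1s.\<close>

lemma word_cong_imp:
  assumes "word_cong S ({(w, N w) | w. w \<in> lists S} \<union> {([1], [])}) u v"
  shows "u \<in> lists S \<and> v \<in> lists S \<and> (\<exists>m n. N (u @ replicate m 1) = N (v @ replicate n 1))"
  using assms
proof induction
  case (rel u v)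
  then consider "v = N u" | "u = [1]" "v = []" by blast
  then show ?case
  proof cases
    case 1
    then have "N (u @ replicate 0 1) = N (v @ replicate 0 1)" using rel by simp
    then show ?thesis using rel by blast
  next
    case 2
    then have "N (u @ replicate 0 1) = N (v @ replicate 1 1)" by simp
    then show ?thesis using rel by blast
  qed
next
  case (sym u v)
  then show ?case by metis
next
  case (trans u v w)
  then obtain m n m' n' where
    "N (u @ replicate m 1) = N (v @ replicate n 1)" "N (v @ replicate m' 1) = N (w @ replicate n' 1)"
    by blast
  \<comment> \<open>Both equations are padded until they share the word \<open>v\<close> followed by
    \<open>n + m'\<close> letters 1.\<close>
  then have "N (u @ replicate (m + m') 1) = N (w @ replicate (n' + n) 1)"
    using trans N_add_ones[of u v m n m'] N_add_ones[of v w m' n' n] by (simp add: add.commute)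
  then show ?case using trans by blast
next
  case (mult u v u' v')
  then obtain m n m' n' where
    "N (u @ replicate m 1) = N (v @ replicate n 1)" "N (u' @ replicate m' 1) = N (v' @ replicate n' 1)"
    by blast
  then have "N ((u @ u') @ replicate (m + m') 1) = N ((v @ v') @ replicate (n + n') 1)"
    using mult N_mult_ones by simp
  then show ?case using mult by (metis append_in_lists_conv)
qed blast

lemma prod_eq_iff_word_cong:
  "u \<in> lists S \<Longrightarrow> v \<in> lists S \<Longrightarrow> prod_list u = prod_list v \<longleftrightarrow>
    word_cong S ({(w, N w) | w. w \<in> lists S} \<union> {([1], [])}) u v"
  using mod unfolding normalisation_mod_def presented_by_def by blast

lemma prod_N [simp]: assumes "w \<in> lists S" shows "prod_list (N w) = prod_list w"
proof -
  have "word_cong S ({(w, N w) | w. w \<in> lists S} \<union> {([1], [])}) w (N w)"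
    using assms by (intro word_cong.rel) auto
  then show ?thesis using prod_eq_iff_word_cong[of w "N w"] assms by simp
qed

text \<open>The choice is harmless: by \<open>N_eq_NF\<close> every geodesic word for
  \<open>f\<close> has this normal form.\<close>

definition NF :: "'a \<Rightarrow> 'a list" where
  "NF f = N (SOME w. w \<in> lists S \<and> length w = len f \<and> prod_list w = f)"

lemma NF_props: "NF f \<in> lists S" "length (NF f) = len f" "prod_list (NF f) = f"
  and N_NF: "N (NF f) = NF f"
proof -
  have "\<exists>w. w \<in> lists S \<and> length w = len f \<and> prod_list w = f"
    using geodesic_word_ex[of f] by blast
  from someI_ex[OF this] show "NF f \<in> lists S" "length (NF f) = len f" "prod_list (NF f) = f"
    "N (NF f) = NF f"
    unfolding NF_def by simp_all
qed

text \<open>Equal products make \<open>w\<close> and the geodesic normal form congruent, hence equal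
  under \<open>N\<close> up to padding; comparing lengths fixes the number of 1s.\<close>

lemma N_eq_NF:
  assumes "w \<in> lists S"
  shows "N w = NF (prod_list w) @ replicate (length w - len (prod_list w)) 1"
proof -
  let ?f = "prod_list w"
  have "word_cong S ({(w, N w) | w. w \<in> lists S} \<union> {([1], [])}) w (NF ?f)"
    using prod_eq_iff_word_cong[of w "NF ?f"] assms NF_props[of ?f] by simp
  then obtain m n where "N (w @ replicate m 1) = N (NF ?f @ replicate n 1)"
    using word_cong_imp by blast
  then have eq: "N w @ replicate m 1 = NF ?f @ replicate n 1"
    using assms NF_props(1)[of ?f] by (simp add: N_append_ones N_NF)
  then have "length w + m = len ?f + n"
    using assms NF_props(2)[of ?f] by (metis length_N length_append length_replicate)
  then have "n = (length w - len ?f) + m" using len_le[OF assms] by simp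
  then show ?thesis using eq by (simp add: replicate_add)
qed

lemma one_notin_NF: "1 \<notin> set (NF f)"
proof
  assume "1 \<in> set (NF f)"
  then obtain xs ys where xy: "NF f = xs @ 1 # ys" by (meson split_list)
  then have "len f \<le> length (xs @ ys)"
    using len_le[of "xs @ ys"] NF_props[of f] by simp
  then show False using xy NF_props(2)[of f] by simp
qed

text \<open>The appended 1 supplies the first letter when \<open>NF f\<close> is empty, that is, for
  \<open>f = 1\<close>.\<close>

definition eta :: "'a \<Rightarrow> 'a \<times> 'a" where
  "eta f = (hd (NF f @ [1]), prod_list (tl (NF f)))"

text \<open>The word \<open>a # w\<close> may fail to be geodesic: it is \<open>NF\<close> of its
  product followed by 1s, which do not affect the product of the tail.\<close>

lemma eta_normal:
  assumes "a # w \<in> lists S" "N (a # w) = a # w"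
  shows "eta (a * prod_list w) = (a, prod_list w)"
proof -
  let ?f = "a * prod_list w"
  obtain k where *: "a # w = NF ?f @ replicate k 1"
    using N_eq_NF[OF assms(1), unfolded assms(2)] by (simp only: prod_list.Cons)
  show ?thesis
  proof (cases "NF ?f")
    case Nil
    then have "a = 1" "prod_list w = 1" using * by (cases k; simp)+
    then show ?thesis using Nil by (simp add: eta_def)
  next
    case (Cons b v)
    then show ?thesis using * by (simp add: eta_def)
  qed
qed

lemma factorisation_map_eta: "factorisation_map S eta"
  unfolding factorisation_map_def
proof (intro conjI allI impI)
  show "eta 1 = (1, 1)" using NF_props(2)[of 1] by (simp add: eta_def)
  fix f :: 'a assume "f \<noteq> 1"
  then obtain a w where aw: "NF f = a # w"
    using NF_props(2)[of f] by (cases "NF f") auto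
  then have eta: "eta f = (a, prod_list w)" by (simp add: eta_def)
  have S: "a \<in> S" "w \<in> lists S" using NF_props(1)[of f] aw by auto
  have f: "a * prod_list w = f" "len f = Suc (length w)" using NF_props(2,3)[of f] aw by auto
  show a: "fst (eta f) \<in> S - {1}" using one_notin_NF[of f] aw S eta by auto
  show "fst (eta f) * snd (eta f) = f" using f eta by simp
  show "len f = len (fst (eta f)) + len (snd (eta f))"
    using a eta f len_letter[of a] len_mult_le[of a "prod_list w"] len_le[OF S(2)] by simp
qed

end

sublocale normalised \<subseteq> factorisation S eta
  by unfold_locales (rule factorisation_map_eta)

context normalised
begin

lemma normal_iff_pairs:
  "w \<in> lists S \<Longrightarrow> N w = w \<longleftrightarrow> (\<forall>x. sublist x w \<and> length x = 2 \<longrightarrow> N x = x)"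
  using quadratic unfolding quadratic_normalisation_def normal_def by blast

lemma normal_Cons_Cons_iff:
  "a \<in> S \<Longrightarrow> b \<in> S \<Longrightarrow> w \<in> lists S \<Longrightarrow>
    N (a # b # w) = a # b # w \<longleftrightarrow> N [a, b] = [a, b] \<and> N (b # w) = b # w"
  using normal_iff_pairs[of "a # b # w"] normal_iff_pairs[of "b # w"]
    all_pairs_Cons_Cons[of a b w "\<lambda>x. N x = x"] by simp

text \<open>Tails of normal words are normal, as normality is decided on pairs, so
  \<open>eta_normal\<close> recovers the letters one by one.\<close>

lemma normal_eq_nf: "w \<in> lists S \<Longrightarrow> N w = w \<Longrightarrow> w = nf eta (length w) (prod_list w)"
proof (induction w)
  case (Cons a w)
  have "N w = w"
    using normal_iff_pairs[of "a # w"] normal_iff_pairs[of w] Cons.prems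
      sublist_Cons_right[of _ a w] by simp
  then show ?case using Cons eta_normal[of a w] by simp
qed simp

lemma N_eq_nf: "w \<in> lists S \<Longrightarrow> N w = nf eta (length w) (prod_list w)"
  using normal_eq_nf[of "N w"] by simp

lemma normal_pair_iff: "a \<in> S \<Longrightarrow> b \<in> S \<Longrightarrow> N [a, b] = [a, b] \<longleftrightarrow> eta (a * b) = (a, b)"
  using nf_two_mult[of a b] by (simp add: N_eq_nf numeral_2_eq_2 prod_eq_iff)

lemma normal_nf: "len f \<le> n \<Longrightarrow> N (nf eta n f) = nf eta n f"
  by (simp add: N_eq_nf prod_nf)

lemma domino_eta:
  assumes wd: "weak_domino_rule S 1 (Nbar N)"
  shows "domino S eta"
proof unfold_locales
  fix f s g t h
  assume "eta f = (s, g)" "eta g = (t, h)"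
  \<comment> \<open>The length exposes \<open>s\<close> and \<open>t\<close> and is at least
    \<open>len f\<close>, so that \<open>normal_nf\<close> applies.\<close>
  then have nf: "nf eta (Suc (Suc (len f))) f = s # t # nf eta (len f) h" by simp
  then have S: "s \<in> S" "t \<in> S" using nf_in_lists[of "Suc (Suc (len f))" f] by auto
  have "N (s # t # nf eta (len f) h) = s # t # nf eta (len f) h"
    using normal_nf[of f "Suc (Suc (len f))"] nf by simp
  then show "eta (s * t) = (s, t)"
    using normal_Cons_Cons_iff[of s t "nf eta (len f) h"] normal_pair_iff S by simp
next
  fix s t h
  assume st: "eta (s * t) = (s, t)" and th: "eta (t * h) = (t, h)"
  have S: "s \<in> S" "t \<in> S" using eta_eqD(1)[OF st] eta_eqD(1)[OF th] by simp_all
  have "len (t * h) \<le> Suc (len h)" using len_mult_le[of t h] len_letter_le[OF S(2)] by simp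
  \<comment> \<open>Spelling out \<open>h\<close> as a word lets locality for words settle arbitrary
    elements \<open>h\<close>.\<close>
  then have "N (t # nf eta (len h) h) = t # nf eta (len h) h"
    using normal_nf[of "t * h" "Suc (len h)"] th by simp
  then have "N (s # t # nf eta (len h) h) = s # t # nf eta (len h) h"
    using normal_Cons_Cons_iff[of s t "nf eta (len h) h"] normal_pair_iff S st by simp
  then show "eta (s * (t * h)) = (s, t * h)"
    using eta_normal[of s "t # nf eta (len h) h"] S by (simp add: prod_nf)
next
  fix s0 r1 r2 r1' s1 r2' s2
  assume S: "s0 \<in> S" "r1 \<in> S" "r2 \<in> S"
    and eta: "eta (s0 * r1) = (r1', s1)" "eta (s1 * r2) = (r2', s2)" "eta (r1 * r2) = (r1, r2)"
    and ne: "r1' \<noteq> 1" "r2' \<noteq> 1" "s2 \<noteq> 1"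
  have Nbar: "Nbar N (a, b) = eta (a * b)" if "a \<in> S" "b \<in> S" for a b
    using Nbar_nf[OF N_eq_nf that] .
  have S1: "r1' \<in> S" "s1 \<in> S"
    using eta_eqD(1)[OF eta(1)] eta_snd_mult[OF S(1,2)] eta(1) by simp_all
  have S2: "r2' \<in> S" "s2 \<in> S"
    using eta_eqD(1)[OF eta(2)] eta_snd_mult[OF S1(2) S(3)] eta(2) by simp_all
  \<comment> \<open>The fixed-point premises for \<open>(r1', s1)\<close> and
    \<open>(r2', s2)\<close> follow from \<open>r1' * s1 = s0 * r1\<close> and
    \<open>r2' * s2 = s1 * r2\<close>.\<close>
  have "Nbar N (s0, r1) = (r1', s1)" "Nbar N (s1, r2) = (r2', s2)" "Nbar N (r1, r2) = (r1, r2)"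
    "Nbar N (r1', s1) = (r1', s1)" "Nbar N (r2', s2) = (r2', s2)"
    using S S1 S2 eta eta_eqD(2)[OF eta(1)] eta_eqD(2)[OF eta(2)] by (simp_all add: Nbar)
  then have "Nbar N (r1', r2') = (r1', r2')"
    using wd S S1 S2 ne unfolding weak_domino_rule_def by blast
  then show "eta (r1' * r2') = (r1', r2')" using S1 S2 by (simp add: Nbar)
qed

end

theorem theorem4p1p2:
  fixes S :: "'a::monoid_mult set"
  assumes "generates S"
    and "1 \<in> S"
  shows "(\<exists>\<eta>. factorability_structure S \<eta>) \<longleftrightarrow>
    (\<exists>N. quadratic_normalisation S N \<and> normalisation_mod S N 1 \<and>
         weak_domino_rule S 1 (Nbar N))"
proof
  assume "\<exists>\<eta>. factorability_structure S \<eta>"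
  then obtain \<eta> where fs: "factorability_structure S \<eta>" by blast
  then have "factorisation_map S \<eta>" unfolding factorability_structure_def by blast
  then interpret factorable S \<eta> using assms fs by unfold_locales
  show "\<exists>N. quadratic_normalisation S N \<and> normalisation_mod S N 1 \<and> weak_domino_rule S 1 (Nbar N)"
    using quadratic_normalisation_norm normalisation_mod_nf weak_domino_norm by blast
next
  assume "\<exists>N. quadratic_normalisation S N \<and> normalisation_mod S N 1 \<and> weak_domino_rule S 1 (Nbar N)"
  then obtain N where N: "quadratic_normalisation S N" "normalisation_mod S N 1"
    "weak_domino_rule S 1 (Nbar N)" by blast
  interpret normalised S N using assms N by unfold_locales
  interpret domino S eta using N(3) by (rule domino_eta)
  show "\<exists>\<eta>. factorability_structure S \<eta>" using factorability_structure_eta by blast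
qed

end
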